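(* Let $G$ and $G^{*}$ be groups, let $P = (\sigma_P, \tau_P, \eta_P)$ be a picture fuzzy subgroup of $G$ and let $Q = (\sigma_Q, \tau_Q, \eta_Q)$ be a picture fuzzy subgroup of $G^{*}$. Then $P \times Q$ is a picture fuzzy subgroup of the group $G \times G^{*}$.
   Context: A picture fuzzy set (PFS) $Q = (\sigma_Q, \tau_Q, \eta_Q)$ of a set $Y$ consists of three functions $\sigma_Q, \tau_Q, \eta_Q : Y \to [0,1]$ with $0 \le \sigma_Q(y) + \tau_Q(y) + \eta_Q(y) \le 1$ for all $y \in Y$. A PFS $Q$ of a group $G$ is a picture fuzzy subgroup (PFSG) of $G$ if for all $a,b \in G$: (i) $\sigma_Q(ab) \ge \min\{\sigma_Q(a), \sigma_Q(b)\}$, $\tau_Q(ab) \ge \min\{\tau_Q(a), \tau_Q(b)\}$, $\eta_Q(ab) \le \max\{\eta_Q(a), \eta_Q(b)\}$; and (ii) $\sigma_Q(a^{-1}) \ge \sigma_Q(a)$, $\tau_Q(a^{-1}) \ge \tau_Q(a)$, $\eta_Q(a^{-1}) \le \eta_Q(a)$. The Cartesian (direct) product of a PFS $P$ of $Y_1$ and a PFS $Q$ of $Y_2$ is the PFS $P \times Q$ of $Y_1 \times Y_2$ given by $\sigma_{P\times Q}(p,q) = \min\{\sigma_P(p), \sigma_Q(q)\}$, $\tau_{P\times Q}(p,q) = \min\{\tau_P(p), \tau_Q(q)\}$, $\eta_{P\times Q}(p,q) = \max\{\eta_P(p), \eta_Q(q)\}$. The group $G \times G^{*}$ is the usual direct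 product of groups. *)

theory Defs
  imports Complex_Main "HOL-Algebra.Group"
begin

(* The membership functions are total on the type; all conditions below, and hence all
   notions, only concern their values on the underlying set Y (or the carrier of the group). *)
record 'a pfs =
  sigma :: "'a \<Rightarrow> real"
  tau :: "'a \<Rightarrow> real"
  eta :: "'a \<Rightarrow> real"

definition picture_fuzzy_set :: "'a set \<Rightarrow> 'a pfs \<Rightarrow> bool" where
  "picture_fuzzy_set Y Q \<longleftrightarrow>
     (\<forall>y\<in>Y. sigma Q y \<in> {0..1} \<and> tau Q y \<in> {0..1} \<and> eta Q y \<in> {0..1} \<and>
       0 \<le> sigma Q y + tau Q y + eta Q y \<and> sigma Q y + tau Q y + eta Q y \<le> 1)"

definition picture_fuzzy_subgroup :: "('a, 'b) monoid_scheme \<Rightarrow> 'a pfs \<Rightarrow> bool" where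
  "picture_fuzzy_subgroup G Q \<longleftrightarrow>
     group G \<and> picture_fuzzy_set (carrier G) Q \<and>
     (\<forall>a\<in>carrier G. \<forall>b\<in>carrier G.
        sigma Q (a \<otimes>\<^bsub>G\<^esub> b) \<ge> min (sigma Q a) (sigma Q b) \<and>
        tau Q (a \<otimes>\<^bsub>G\<^esub> b) \<ge> min (tau Q a) (tau Q b) \<and>
        eta Q (a \<otimes>\<^bsub>G\<^esub> b) \<le> max (eta Q a) (eta Q b)) \<and>
     (\<forall>a\<in>carrier G.
        sigma Q (inv\<^bsub>G\<^esub> a) \<ge> sigma Q a \<and>
        tau Q (inv\<^bsub>G\<^esub> a) \<ge> tau Q a \<and>
        eta Q (inv\<^bsub>G\<^esub> a) \<le> eta Q a)"

definition pfs_prod :: "'a pfs \<Rightarrow> 'b pfs \<Rightarrow> ('a \<times> 'b) pfs" where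
  "pfs_prod P Q =
     \<lparr>sigma = (\<lambda>(p, q). min (sigma P p) (sigma Q q)),
      tau = (\<lambda>(p, q). min (tau P p) (tau Q q)),
      eta = (\<lambda>(p, q). max (eta P p) (eta Q q))\<rparr>"

end

theory Submission
  imports Defs
begin

text \<open>
  Multiplication and inversion in the direct product are componentwise, and \<open>min\<close> and \<open>max\<close> are
  monotone, so the subgroup inequalities of the factors combine entry by entry. The delicate
  condition is that the three degrees still sum to at most \<open>1\<close>, because the third degree of the
  product is a maximum. That maximum is attained in one of the factors, and the two minima are
  bounded by the degrees in the same factor, so the sum is bounded by the sum in that factor.
\<close>

lemma pfs_prod_simps [simp]:
  "sigma (pfs_prod P Q) (p, q) = min (sigma P p) (sigma Q q)"
  "tau (pfs_prod P Q) (p, q) = min (tau P p) (tau Q q)"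
  "eta (pfs_prod P Q) (p, q) = max (eta P p) (eta Q q)"
  by (simp_all add: pfs_prod_def)

lemma picture_fuzzy_set_pfs_prod:
  assumes "picture_fuzzy_set Y P" and "picture_fuzzy_set Z Q"
  shows "picture_fuzzy_set (Y \<times> Z) (pfs_prod P Q)"
  unfolding picture_fuzzy_set_def
proof (rule ballI)
  fix y assume "y \<in> Y \<times> Z"
  then obtain p q where y: "y = (p, q)" and "p \<in> Y" "q \<in> Z" by blast
  then have "sigma P p \<in> {0..1} \<and> tau P p \<in> {0..1} \<and> eta P p \<in> {0..1} \<and>
      sigma P p + tau P p + eta P p \<le> 1"
    and "sigma Q q \<in> {0..1} \<and> tau Q q \<in> {0..1} \<and> eta Q q \<in> {0..1} \<and>
      sigma Q q + tau Q q + eta Q q \<le> 1"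
    using assms by (simp_all add: picture_fuzzy_set_def)
  then show "sigma (pfs_prod P Q) y \<in> {0..1} \<and> tau (pfs_prod P Q) y \<in> {0..1} \<and>
      eta (pfs_prod P Q) y \<in> {0..1} \<and>
      0 \<le> sigma (pfs_prod P Q) y + tau (pfs_prod P Q) y + eta (pfs_prod P Q) y \<and>
      sigma (pfs_prod P Q) y + tau (pfs_prod P Q) y + eta (pfs_prod P Q) y \<le> 1"
    by (auto simp: y min_def max_def)
qed

text \<open>
  Minima and maxima over the two factors and over the two arguments can be taken in either order;
  these rules carry out that exchange.
\<close>

lemma min_min_le_exchange:
  fixes a b c d x y :: real
  assumes "min a b \<le> x" and "min c d \<le> y"
  shows "min (min a c) (min b d) \<le> min x y"
  using assms by linarith

lemma max_le_max_max_exchange: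
  fixes a b c d x y :: real
  assumes "x \<le> max a b" and "y \<le> max c d"
  shows "max x y \<le> max (max a c) (max b d)"
  using assms by linarith

theorem theorem3p2:
  fixes G :: "('a, 'c) monoid_scheme" and G' :: "('b, 'd) monoid_scheme"
    and P :: "'a pfs" and Q :: "'b pfs"
  assumes "group G" and "group G'"
    and "picture_fuzzy_subgroup G P" and "picture_fuzzy_subgroup G' Q"
  shows "picture_fuzzy_subgroup (G \<times>\<times> G') (pfs_prod P Q)"
  unfolding picture_fuzzy_subgroup_def
proof (intro conjI ballI)
  show "group (G \<times>\<times> G')" using assms(1,2) by (rule DirProd_group)
  show "picture_fuzzy_set (carrier (G \<times>\<times> G')) (pfs_prod P Q)"
    using assms(3,4) by (simp add: picture_fuzzy_subgroup_def picture_fuzzy_set_pfs_prod)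
next
  fix a b assume "a \<in> carrier (G \<times>\<times> G')" "b \<in> carrier (G \<times>\<times> G')"
  then obtain p q r s where ab: "a = (p, q)" "b = (r, s)"
    and mem: "p \<in> carrier G" "q \<in> carrier G'" "r \<in> carrier G" "s \<in> carrier G'"
    by auto
  show "min (sigma (pfs_prod P Q) a) (sigma (pfs_prod P Q) b)
      \<le> sigma (pfs_prod P Q) (a \<otimes>\<^bsub>G \<times>\<times> G'\<^esub> b)"
    unfolding ab mult_DirProd pfs_prod_simps
    by (rule min_min_le_exchange) (use assms(3,4) mem in \<open>simp_all add: picture_fuzzy_subgroup_def\<close>)
  show "min (tau (pfs_prod P Q) a) (tau (pfs_prod P Q) b)
      \<le> tau (pfs_prod P Q) (a \<otimes>\<^bsub>G \<times>\<times> G'\<^esub> b)"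
    unfolding ab mult_DirProd pfs_prod_simps
    by (rule min_min_le_exchange) (use assms(3,4) mem in \<open>simp_all add: picture_fuzzy_subgroup_def\<close>)
  show "eta (pfs_prod P Q) (a \<otimes>\<^bsub>G \<times>\<times> G'\<^esub> b)
      \<le> max (eta (pfs_prod P Q) a) (eta (pfs_prod P Q) b)"
    unfolding ab mult_DirProd pfs_prod_simps
    by (rule max_le_max_max_exchange)
      (use assms(3,4) mem in \<open>simp_all add: picture_fuzzy_subgroup_def\<close>)
next
  fix a assume "a \<in> carrier (G \<times>\<times> G')"
  then obtain p q where a: "a = (p, q)" and mem: "p \<in> carrier G" "q \<in> carrier G'"
    by auto
  have inv: "inv\<^bsub>G \<times>\<times> G'\<^esub> a = (inv\<^bsub>G\<^esub> p, inv\<^bsub>G'\<^esub> q)"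
    unfolding a using assms(1,2) mem by (rule inv_DirProd)
  show "sigma (pfs_prod P Q) a \<le> sigma (pfs_prod P Q) (inv\<^bsub>G \<times>\<times> G'\<^esub> a)"
    unfolding inv unfolding a pfs_prod_simps
    by (rule min.mono) (use assms(3,4) mem in \<open>simp_all add: picture_fuzzy_subgroup_def\<close>)
  show "tau (pfs_prod P Q) a \<le> tau (pfs_prod P Q) (inv\<^bsub>G \<times>\<times> G'\<^esub> a)"
    unfolding inv unfolding a pfs_prod_simps
    by (rule min.mono) (use assms(3,4) mem in \<open>simp_all add: picture_fuzzy_subgroup_def\<close>)
  show "eta (pfs_prod P Q) (inv\<^bsub>G \<times>\<times> G'\<^esub> a) \<le> eta (pfs_prod P Q) a"
    unfolding inv unfolding a pfs_prod_simps
    by (rule max.mono) (use assms(3,4) mem in \<open>simp_all add: picture_fuzzy_subgroup_def\<close>)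
qed

end
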